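(* Let $M=(E,r)$ be a $q$-matroid and let $A\le E$ with $n(A)=a$. The following are equivalent: (1) $A$ is cyclic in $M$; (2) $A$ is minimal with respect to inclusion in $N_a=\{B\le E: n(B)=a\}$; (3) $A^\perp$ is a flat of the dual $q$-matroid $M^*$.
   Context: Let $q$ be a prime power and $E$ an $n$-dimensional $\mathbb{F}_q$-vector space with a fixed non-degenerate bilinear form; $A^\perp$ denotes the orthogonal complement of $A$ in $E$. A $q$-matroid $(E,r)$ is a function $r$ from subspaces of $E$ to $\mathbb{Z}$ with (R1) $0\le r(A)\le\dim A$, (R2) $r(A)\le r(B)$ if $A\le B$, (R3) $r(A+B)+r(A\cap B)\le r(A)+r(B)$. The nullity is $n(A)=\dim A-r(A)$. A subspace $A$ is cyclic if $r(B)=r(A)$ for every subspace $B\le A$ of codimension $1$ in $A$. The dual $q$-matroid is $M^*=(E,r^* )$ with $r^*(A)=\dim A-r(E)+r(A^\perp)$. A subspace $F$ is a flat of a $q$-matroid with rank function $\rho$ if $\rho(F+x)>\rho(F)$ for every $1$-dimensional $x\le E$ with $x\not\le F$.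
   Formalization: The fixed non-degenerate bilinear form is additionally assumed to have a symmetric orthogonality relation (as for symmetric or alternating forms); with one-sided complements of other non-degenerate forms, the equivalence with (3) can fail. *)

theory Defs
  imports Complex_Main "HOL-Library.Set_Algebras"
begin

text \<open>
  The space \<open>E\<close> is the whole type \<open>'v\<close>, a finite-dimensional vector space over a finite
  field \<open>'f\<close>. Rank functions are functions on arbitrary subsets of \<open>E\<close>, but only their values
  on subspaces are constrained or used. The sum \<open>A + B\<close> of subspaces is the elementwise sum of
  \<open>Set_Algebras\<close>.
\<close>

locale finite_field_space = finite_dimensional_vector_space scale Basis
  for scale :: "'f::{field,finite} \<Rightarrow> 'v::ab_group_add \<Rightarrow> 'v" (infixr \<open>*s\<close> 75)
    and Basis :: "'v set"

locale q_matroid = finite_field_space scale Basis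
  for scale :: "'f::{field,finite} \<Rightarrow> 'v::ab_group_add \<Rightarrow> 'v" (infixr \<open>*s\<close> 75)
    and Basis :: "'v set" +
  fixes r :: "'v set \<Rightarrow> int"
  assumes rank_nonneg: "subspace A \<Longrightarrow> 0 \<le> r A"
    and rank_le_dim: "subspace A \<Longrightarrow> r A \<le> int (dim A)"
    and rank_mono: "subspace A \<Longrightarrow> subspace B \<Longrightarrow> A \<subseteq> B \<Longrightarrow> r A \<le> r B"
    and rank_submodular:
      "subspace A \<Longrightarrow> subspace B \<Longrightarrow> r (A + B) + r (A \<inter> B) \<le> r A + r B"

text \<open>
  Symmetry is not assumed, only reflexivity, that is, symmetry of the orthogonality relation.
  This covers symmetric and alternating forms and is what makes \<open>the\<close> orthogonal complement
  meaningful: the left and the right complement coincide.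
\<close>

locale nondegenerate_form = vector_space scale
  for scale :: "'f::field \<Rightarrow> 'v::ab_group_add \<Rightarrow> 'v" (infixr \<open>*s\<close> 75) +
  fixes form :: "'v \<Rightarrow> 'v \<Rightarrow> 'f"
  assumes linear_left: "Vector_Spaces.linear scale (*) (\<lambda>x. form x y)"
    and linear_right: "Vector_Spaces.linear scale (*) (\<lambda>y. form x y)"
    and reflexive: "form x y = 0 \<Longrightarrow> form y x = 0"
    and nondegenerate_left: "(\<And>y. form x y = 0) \<Longrightarrow> x = 0"
    and nondegenerate_right: "(\<And>x. form x y = 0) \<Longrightarrow> y = 0"

definition orthogonal_complement ::
    "('v \<Rightarrow> 'v \<Rightarrow> 'f::zero) \<Rightarrow> 'v set \<Rightarrow> 'v set" where
  "orthogonal_complement form A = {y. \<forall>x\<in>A. form x y = 0}"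

context finite_field_space
begin

definition nullity :: "('v set \<Rightarrow> int) \<Rightarrow> 'v set \<Rightarrow> int" where
  "nullity r A = int (dim A) - r A"

definition cyclic_subspace :: "('v set \<Rightarrow> int) \<Rightarrow> 'v set \<Rightarrow> bool" where
  "cyclic_subspace r A \<longleftrightarrow> subspace A \<and>
     (\<forall>B. subspace B \<and> B \<subseteq> A \<and> dim A = dim B + 1 \<longrightarrow> r B = r A)"

definition flat :: "('v set \<Rightarrow> int) \<Rightarrow> 'v set \<Rightarrow> bool" where
  "flat r F \<longleftrightarrow> subspace F \<and>
     (\<forall>x. subspace x \<and> dim x = 1 \<and> \<not> x \<subseteq> F \<longrightarrow> r (F + x) > r F)"

definition dual_rank :: "('v \<Rightarrow> 'v \<Rightarrow> 'f) \<Rightarrow> ('v set \<Rightarrow> int) \<Rightarrow> 'v set \<Rightarrow> int" where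
  "dual_rank form r A = int (dim A) - r UNIV + r (orthogonal_complement form A)"

definition subspaces_of_nullity :: "('v set \<Rightarrow> int) \<Rightarrow> int \<Rightarrow> 'v set set" where
  "subspaces_of_nullity r a = {B. subspace B \<and> nullity r B = a}"

end

end

theory Submission
  imports Defs
begin

text \<open>
  Nullity is monotone along inclusions, and a proper inclusion \<open>B \<subset> A\<close> factors through a
  hyperplane of \<open>A\<close>; hence both cyclicity and minimality say that every hyperplane of \<open>A\<close> has
  smaller nullity. Taking orthogonal complements turns the hyperplanes of \<open>A\<close> into the
  subspaces \<open>A\<^sup>\<bottom> + x\<close> with \<open>x\<close> a line outside \<open>A\<^sup>\<bottom>\<close>, and the rank jump in the dual
  equals one minus the rank jump from the hyperplane to \<open>A\<close>.
\<close>

section \<open>Sums of subspaces as spans\<close>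

context vector_space
begin

lemma span_Un_eq_plus: "span (S \<union> T) = span S + span T"
  unfolding span_Un set_plus_def by blast

lemma subspace_plus: "subspace S \<Longrightarrow> subspace T \<Longrightarrow> subspace (S + T)"
  by (metis span_Un_eq_plus span_eq_iff subspace_span)

lemma plus_span_singleton: "subspace S \<Longrightarrow> S + span {x} = span (insert x S)"
  by (metis span_Un_eq_plus span_eq_iff Un_insert_right sup_bot_right)

end

section \<open>Adapted bases and hyperplanes\<close>

context finite_dimensional_vector_space
begin

lemma dim_one_eq_span_singleton:
  assumes "subspace X" "dim X = 1"
  obtains x where "x \<noteq> 0" "X = span {x}"
proof -
  obtain B where B: "independent B" "span B = X" "card B = dim X"
    by (rule basis_subspace_exists[OF assms(1)])
  then obtain x where x: "B = {x}"
    using assms(2) by (auto simp: card_1_singleton_iff)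
  have "x \<noteq> 0"
    using B(1) x dependent_zero by blast
  then show thesis
    using that B(2) x by blast
qed

text \<open>Nested bases let auxiliary subspaces be found by removing vectors: \<open>T - S\<close>
  spans a complement of \<open>B\<close> in \<open>A\<close>, and \<open>T\<close> without one
  vector of \<open>T - S\<close> spans a hyperplane of \<open>A\<close> containing
  \<open>B\<close>.\<close>

lemma extend_subspace_basis:
  assumes "subspace B" "subspace A" "B \<subseteq> A"
  obtains S T where "S \<subseteq> T" "finite T" "independent T" "span S = B" "span T = A"
    "card S = dim B" "card T = dim A"
proof -
  obtain S where S: "S \<subseteq> B" "independent S" "span S = B" "card S = dim B"
    by (rule basis_subspace_exists[OF assms(1)])
  then have "S \<subseteq> A" using assms(3) by blast
  then obtain T where T: "S \<subseteq> T" "T \<subseteq> A" "independent T" "A \<subseteq> span T"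
    by (rule maximal_independent_subset_extend[OF _ S(2)])
  then have "span T = A"
    using assms(2) span_subspace by blast
  moreover have "card T = dim A"
    using \<open>span T = A\<close> dim_span_eq_card_independent[OF T(3)] by simp
  ultimately show thesis
    by (rule that[OF T(1) finiteI_independent[OF T(3)] T(3) S(3) _ S(4)])
qed

lemma subspace_hyperplane_extend:
  assumes "subspace B" "subspace A" "B \<subset> A"
  obtains H where "subspace H" "B \<subseteq> H" "H \<subseteq> A" "dim A = dim H + 1"
proof -
  obtain S T where ST: "S \<subseteq> T" "finite T" "independent T" "span S = B" "span T = A" "card T = dim A"
    by (rule extend_subspace_basis[OF assms(1,2) psubset_imp_subset[OF assms(3)]])
  \<comment> \<open>Otherwise \<open>A\<close> would lie in \<open>B\<close>, against properness.
    The vector \<open>y\<close> found here is the one to drop: the rest of \<open>T\<close> still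
    contains \<open>S\<close>.\<close>
  have "\<not> T \<subseteq> S"
    using ST(4,5) assms(3) span_mono[of T S] by blast
  then obtain y where y: "y \<in> T" "y \<notin> S" by blast
  have "independent (T - {y})"
    using ST(3) independent_mono by blast
  then have "dim (span (T - {y})) = card (T - {y})"
    by (rule dim_span_eq_card_independent)
  moreover have "card T = card (T - {y}) + 1"
    using y(1) ST(2) by (metis Suc_eq_plus1 card_Suc_Diff1)
  moreover have "B \<subseteq> span (T - {y})"
    using ST(1,4) y(2) span_mono[of S "T - {y}"] by blast
  moreover have "span (T - {y}) \<subseteq> A"
    using ST(5) span_mono[of "T - {y}" T] by blast
  ultimately show thesis
    using that[of "span (T - {y})"] ST(6) by simp
qed

text \<open>A vector outside \<open>H\<close> raises the dimension by one, which already exhausts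
  \<open>A\<close>.\<close>

lemma hyperplane_eq_span_insert:
  assumes "subspace H" "subspace A" "H \<subseteq> A" "dim A = dim H + 1" "x \<in> A" "x \<notin> H"
  shows "span (insert x H) = A"
proof (rule subspace_dim_equal)
  show "span (insert x H) \<subseteq> A"
    using assms(2,3,5) by (intro span_minimal) auto
  have "x \<notin> span H"
    using assms(1,6) by (metis span_eq_iff)
  then show "dim A \<le> dim (span (insert x H))"
    using assms(4) by (simp add: dim_insert)
qed (use assms in simp_all)

end

section \<open>Nullity and cyclic subspaces\<close>

context q_matroid
begin

text \<open>Submodularity for \<open>B\<close> and a complement \<open>C\<close> of \<open>B\<close>
  in \<open>A\<close>: the rank of \<open>C\<close> is at most its dimension, which is the
  codimension of \<open>B\<close>, and the rank of the intersection is bounded below by 0.\<close>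

lemma rank_le_plus_codim:
  assumes "subspace A" "subspace B" "B \<subseteq> A"
  shows "r A \<le> r B + (int (dim A) - int (dim B))"
proof -
  obtain S T where ST: "S \<subseteq> T" "finite T" "independent T" "span S = B" "span T = A"
    "card S = dim B" "card T = dim A"
    by (rule extend_subspace_basis[OF assms(2,1,3)])
  define C where "C = span (T - S)"
  have C: "subspace C"
    by (simp add: C_def)
  have "independent (T - S)"
    using ST(3) independent_mono by blast
  then have "dim C = card (T - S)"
    unfolding C_def by (rule dim_span_eq_card_independent)
  also have "\<dots> = card T - card S"
    using ST(1) finite_subset[OF ST(1,2)] by (rule card_Diff_subset[rotated])
  finally have "int (dim C) = int (dim A) - int (dim B)"
    using ST dim_subset[OF assms(3)] by simp
  moreover have "B + C = A"
    unfolding C_def using ST(1,4,5) span_Un_eq_plus[of S "T - S"]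
    by (simp add: Un_absorb1)
  ultimately show ?thesis
    using rank_submodular[OF assms(2) C] rank_le_dim[OF C]
      rank_nonneg[OF subspace_inter[OF assms(2) C]] by simp
qed

lemma nullity_mono:
  assumes "subspace A" "subspace B" "B \<subseteq> A"
  shows "nullity r B \<le> nullity r A"
  using rank_le_plus_codim[OF assms] unfolding nullity_def by simp

lemma cyclic_subspace_iff_minimal_nullity:
  assumes A: "subspace A" and a: "nullity r A = a"
  shows "cyclic_subspace r A \<longleftrightarrow> A \<in> subspaces_of_nullity r a \<and>
    (\<forall>B \<in> subspaces_of_nullity r a. B \<subseteq> A \<longrightarrow> B = A)"
proof
  assume cyc: "cyclic_subspace r A"
  have "B = A" if B: "subspace B" "nullity r B = a" "B \<subseteq> A" for B
  proof (rule ccontr)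
    assume "B \<noteq> A"
    with B(3) have "B \<subset> A" by blast
    then obtain H where H: "subspace H" "B \<subseteq> H" "H \<subseteq> A" "dim A = dim H + 1"
      by (rule subspace_hyperplane_extend[OF B(1) A])
    \<comment> \<open>Since \<open>r H = r A\<close>, the nullity of \<open>H\<close> is
      \<open>a - 1\<close>, so that of \<open>B\<close> cannot be \<open>a\<close>.\<close>
    have "nullity r B \<le> nullity r H"
      using H(1,2) B(1) by (intro nullity_mono)
    moreover have "r H = r A"
      using cyc H unfolding cyclic_subspace_def by blast
    ultimately show False
      using H(4) a B(2) unfolding nullity_def by simp
  qed
  then show "A \<in> subspaces_of_nullity r a \<and>
    (\<forall>B \<in> subspaces_of_nullity r a. B \<subseteq> A \<longrightarrow> B = A)"
    using A a unfolding subspaces_of_nullity_def by blast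
next
  assume min: "A \<in> subspaces_of_nullity r a \<and>
    (\<forall>B \<in> subspaces_of_nullity r a. B \<subseteq> A \<longrightarrow> B = A)"
  have "r H = r A" if H: "subspace H" "H \<subseteq> A" "dim A = dim H + 1" for H
  proof -
    have "H \<noteq> A"
      using H(3) by auto
    then have "nullity r H \<noteq> a"
      using min H unfolding subspaces_of_nullity_def by blast
    \<comment> \<open>Nullities are integers, so the drop is at least 1. As the dimension drops by
      exactly 1, this gives \<open>r A \<le> r H\<close>; monotonicity gives the converse.\<close>
    then have "nullity r H < nullity r A"
      using nullity_mono[OF A H(1,2)] a by simp
    then show ?thesis
      using H(3) rank_mono[OF H(1) A H(2)] unfolding nullity_def by simp
  qed
  then show "cyclic_subspace r A"
    using A unfolding cyclic_subspace_def by blast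
qed

end

section \<open>Orthogonal complements as a Galois connection\<close>

context nondegenerate_form
begin

lemma subspace_form_kernel: "subspace {y. form x y = 0}"
proof -
  interpret f: Vector_Spaces.linear scale "(*)" "\<lambda>y. form x y"
    by (rule linear_right)
  show ?thesis
    by (rule f.subspace_kernel)
qed

lemma orthogonal_complement_eq_INT:
  "orthogonal_complement form S = (\<Inter>x\<in>S. {y. form x y = 0})"
  unfolding orthogonal_complement_def by blast

lemma subspace_orthogonal_complement: "subspace (orthogonal_complement form S)"
  unfolding orthogonal_complement_eq_INT by (intro subspace_Int subspace_form_kernel)

lemma orthogonal_complement_antimono:
  "S \<subseteq> T \<Longrightarrow> orthogonal_complement form T \<subseteq> orthogonal_complement form S"
  unfolding orthogonal_complement_def by blast

lemma orthogonal_complement_Un: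
  "orthogonal_complement form (S \<union> T) = orthogonal_complement form S \<inter> orthogonal_complement form T"
  unfolding orthogonal_complement_def by blast

text \<open>Elements of \<open>S\<close> move from the first to the second argument of the form;
  \<open>reflexive\<close> permits the swap.\<close>

lemma subset_double_orthogonal_complement:
  "S \<subseteq> orthogonal_complement form (orthogonal_complement form S)"
  unfolding orthogonal_complement_def by (auto intro: reflexive)

lemma orthogonal_complement_span:
  "orthogonal_complement form (span S) = orthogonal_complement form S"
proof
  \<comment> \<open>The double complement is a subspace containing \<open>S\<close>. Taking
    complements once more reverses the inclusion, and the complement of \<open>S\<close> lies in its
    own double complement.\<close>
  have "span S \<subseteq> orthogonal_complement form (orthogonal_complement form S)"
    by (intro span_minimal subset_double_orthogonal_complement subspace_orthogonal_complement)
  then show "orthogonal_complement form S \<subseteq> orthogonal_complement form (span S)"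
    using orthogonal_complement_antimono subset_double_orthogonal_complement by blast
qed (intro orthogonal_complement_antimono span_superset)

lemma orthogonal_complement_UNIV: "orthogonal_complement form UNIV = {0}"
  using nondegenerate_right subspace_0[OF subspace_orthogonal_complement]
  unfolding orthogonal_complement_def by blast

end

section \<open>Dimension of the orthogonal complement\<close>

locale finite_dimensional_form =
  finite_dimensional_vector_space scale Basis + nondegenerate_form scale form
  for scale :: "'f::field \<Rightarrow> 'v::ab_group_add \<Rightarrow> 'v" (infixr \<open>*s\<close> 75)
    and Basis :: "'v set"
    and form :: "'v \<Rightarrow> 'v \<Rightarrow> 'f"
begin

text \<open>One linear equation lowers the dimension by at most one.\<close>

lemma dim_le_dim_Int_form_kernel:
  assumes "subspace S"
  shows "dim S \<le> dim (S \<inter> {y. form x y = 0}) + 1"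
proof (cases "S \<subseteq> {y. form x y = 0}")
  case True
  then show ?thesis by (simp add: Int_absorb2)
next
  case False
  then obtain v where v: "v \<in> S" "form x v \<noteq> 0" by blast
  interpret f: Vector_Spaces.linear scale "(*)" "\<lambda>y. form x y"
    by (rule linear_right)
  let ?K = "S \<inter> {y. form x y = 0}"
  have "S \<subseteq> span (insert v ?K)"
  proof
    fix y assume "y \<in> S"
    \<comment> \<open>The scalar for which subtracting the multiple of \<open>v\<close> moves
      \<open>y\<close> into the kernel.\<close>
    define k where "k = form x y / form x v"
    have "form x (y - k *s v) = 0"
      using v(2) by (simp add: f.diff f.scale k_def)
    moreover have "y - k *s v \<in> S"
      using \<open>y \<in> S\<close> v(1) assms by (intro subspace_diff subspace_scale)
    ultimately show "y \<in> span (insert v ?K)"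
      unfolding span_breakdown_eq by (blast intro: span_base)
  qed
  then have "dim S \<le> dim (insert v ?K)"
    by (rule dim_mono)
  then show ?thesis
    by (simp add: dim_insert split: if_splits)
qed

lemma dimension_le_dim_orthogonal_complement_plus_card:
  assumes "finite S"
  shows "dimension \<le> dim (orthogonal_complement form S) + card S"
  using assms
proof (induction S)
  case empty
  then show ?case
    by (simp add: orthogonal_complement_def dimension_def)
next
  case (insert x S)
  have "orthogonal_complement form (insert x S) = orthogonal_complement form S \<inter> {y. form x y = 0}"
    unfolding orthogonal_complement_def by blast
  then show ?case
    using insert dim_le_dim_Int_form_kernel[OF subspace_orthogonal_complement, of S x] by simp
qed

text \<open>Counting equations bounds the dimensions of \<open>?P\<close> and \<open>?Q\<close> from
  below by \<open>dimension - card S\<close> and \<open>dimension - card (T - S)\<close>. These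
  bounds add up to \<open>dimension\<close>. Non-degeneracy makes \<open>?P\<close> and
  \<open>?Q\<close> meet only in 0, so their dimensions sum to at most \<open>dimension\<close> and
  both bounds are attained.\<close>

lemma dim_orthogonal_complement:
  assumes "subspace A"
  shows "dim A + dim (orthogonal_complement form A) = dimension"
proof -
  obtain S T where ST: "S \<subseteq> T" "finite T" "span S = A" "span T = UNIV"
    "card S = dim A" "card T = dimension"
    using extend_subspace_basis[OF assms subspace_UNIV subset_UNIV]
    unfolding dim_UNIV dimension_def .
  let ?P = "orthogonal_complement form S" and ?Q = "orthogonal_complement form (T - S)"
  have "?P \<inter> ?Q = orthogonal_complement form T"
    using ST(1) orthogonal_complement_Un[of S "T - S"] by (simp add: Un_absorb1)
  also have "\<dots> = {0}"
    using orthogonal_complement_span[of T] ST(4) orthogonal_complement_UNIV by simp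
  finally have "dim (?P \<inter> ?Q) = 0" by simp
  moreover have "dim {x + y |x y. x \<in> ?P \<and> y \<in> ?Q} \<le> dimension"
    by (rule dim_subset_UNIV)
  ultimately have "dim ?P + dim ?Q \<le> dimension"
    using dim_sums_Int[OF subspace_orthogonal_complement subspace_orthogonal_complement, of S "T - S"] by linarith
  moreover have "finite S"
    using ST(1,2) finite_subset by blast
  then have "dimension \<le> dim ?P + card S"
    by (rule dimension_le_dim_orthogonal_complement_plus_card)
  moreover have "dimension \<le> dim ?Q + card (T - S)"
    using ST(2) by (intro dimension_le_dim_orthogonal_complement_plus_card) simp
  moreover have "card T = card (T - S) + card S"
    using ST(1,2) \<open>finite S\<close> by (simp add: card_Diff_subset card_mono)
  moreover have "?P = orthogonal_complement form A"
    using orthogonal_complement_span[of S] ST(3) by simp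
  ultimately show ?thesis
    using ST(5,6) by simp
qed

text \<open>One inclusion holds in general; applying the dimension formula twice shows that the
  dimensions agree.\<close>

lemma double_orthogonal_complement:
  assumes "subspace A"
  shows "orthogonal_complement form (orthogonal_complement form A) = A"
proof (rule subspace_dim_equal[symmetric, OF assms subspace_orthogonal_complement
      subset_double_orthogonal_complement])
  show "dim (orthogonal_complement form (orthogonal_complement form A)) \<le> dim A"
    using dim_orthogonal_complement[OF assms]
      dim_orthogonal_complement[OF subspace_orthogonal_complement, of A] by simp
qed

end

section \<open>Cyclic subspaces and flats of the dual\<close>

locale q_matroid_form = q_matroid scale Basis r + finite_dimensional_form scale Basis form
  for scale :: "'f::{field,finite} \<Rightarrow> 'v::ab_group_add \<Rightarrow> 'v" (infixr \<open>*s\<close> 75)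
    and Basis :: "'v set"
    and r :: "'v set \<Rightarrow> int"
    and form :: "'v \<Rightarrow> 'v \<Rightarrow> 'f"
begin

text \<open>Double complements cancel inside \<open>dual_rank\<close>, so the dual rank grows by
  \<open>1 - (r A - r H)\<close>. As \<open>r A - r H\<close> is a nonnegative integer, this is
  positive exactly when it is 0.\<close>

lemma dual_rank_less_iff:
  assumes "subspace A" "subspace H" "H \<subseteq> A" "dim A = dim H + 1"
  shows "dual_rank form r (orthogonal_complement form A) < dual_rank form r (orthogonal_complement form H)
    \<longleftrightarrow> r H = r A"
  using dim_orthogonal_complement[OF assms(1)] dim_orthogonal_complement[OF assms(2)]
    double_orthogonal_complement[OF assms(1)] double_orthogonal_complement[OF assms(2)]
    rank_mono[OF assms(2,1,3)] assms(4)
  unfolding dual_rank_def by auto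

lemma cyclic_subspace_iff_flat_dual:
  assumes A: "subspace A"
  shows "cyclic_subspace r A \<longleftrightarrow> flat (dual_rank form r) (orthogonal_complement form A)"
    (is "_ \<longleftrightarrow> flat ?d ?P")
proof
  assume cyc: "cyclic_subspace r A"
  have "?d (?P + X) > ?d ?P" if X: "subspace X" "dim X = 1" "\<not> X \<subseteq> ?P" for X
  proof -
    obtain x where x: "X = span {x}"
      by (rule dim_one_eq_span_singleton[OF X(1,2)])
    then have "x \<notin> ?P"
      using X(3) span_minimal[OF _ subspace_orthogonal_complement] by blast
    then have "x \<notin> span ?P"
      using subspace_orthogonal_complement by (metis span_eq_iff)
    \<comment> \<open>The hyperplane of \<open>A\<close> that corresponds to the line
      \<open>X\<close>; its complement is \<open>?P + X\<close> again.\<close>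
    let ?H = "orthogonal_complement form (?P + X)"
    have PX: "subspace (?P + X)"
      by (intro subspace_plus subspace_orthogonal_complement X(1))
    have eq: "?P + X = span (insert x ?P)"
      unfolding x by (rule plus_span_singleton[OF subspace_orthogonal_complement])
    then have "?P \<subseteq> ?P + X"
      using span_superset by blast
    then have "?H \<subseteq> A"
      using orthogonal_complement_antimono[of ?P] double_orthogonal_complement[OF A] by simp
    have "dim (?P + X) = dim ?P + 1"
      unfolding eq using \<open>x \<notin> span ?P\<close> by (simp add: dim_insert)
    then have dim: "dim A = dim ?H + 1"
      using dim_orthogonal_complement[OF A] dim_orthogonal_complement[OF PX] by simp
    then have "r ?H = r A"
      using cyc \<open>?H \<subseteq> A\<close> subspace_orthogonal_complement unfolding cyclic_subspace_def by blast
    then show ?thesis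
      using dual_rank_less_iff[OF A subspace_orthogonal_complement \<open>?H \<subseteq> A\<close> dim]
        double_orthogonal_complement[OF PX] by simp
  qed
  then show "flat ?d ?P"
    unfolding flat_def using subspace_orthogonal_complement by blast
next
  assume flat: "flat ?d ?P"
  have "r H = r A" if H: "subspace H" "H \<subseteq> A" "dim A = dim H + 1" for H
  proof -
    let ?Q = "orthogonal_complement form H"
    have "?P \<subseteq> ?Q"
      using H(2) by (rule orthogonal_complement_antimono)
    have dim: "dim ?Q = dim ?P + 1"
      using dim_orthogonal_complement[OF A] dim_orthogonal_complement[OF H(1)] H(3) by simp
    then have "\<not> ?Q \<subseteq> ?P"
      using dim_subset[of ?Q ?P] by auto
    \<comment> \<open>Since \<open>?P\<close> is a hyperplane of \<open>?Q\<close>, the line through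
      \<open>x\<close> together with \<open>?P\<close> fills \<open>?Q\<close>, so flatness can be
      tested on this line.\<close>
    then obtain x where x: "x \<in> ?Q" "x \<notin> ?P" by blast
    have "?P + span {x} = span (insert x ?P)"
      by (rule plus_span_singleton[OF subspace_orthogonal_complement])
    also have "\<dots> = ?Q"
      by (rule hyperplane_eq_span_insert[OF subspace_orthogonal_complement
            subspace_orthogonal_complement \<open>?P \<subseteq> ?Q\<close> dim x])
    finally have "?P + span {x} = ?Q" .
    moreover have "\<not> span {x} \<subseteq> ?P"
      using x(2) span_base by blast
    moreover have "dim (span {x}) = 1"
      using x(2) subspace_0[OF subspace_orthogonal_complement] by auto
    ultimately have "?d ?P < ?d ?Q"
      using flat unfolding flat_def by (metis subspace_span)
    then show ?thesis
      using dual_rank_less_iff[OF A H] by simp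
  qed
  then show "cyclic_subspace r A"
    unfolding cyclic_subspace_def using A by blast
qed

end

theorem theorem2p12:
  fixes scale :: "'f::{field,finite} \<Rightarrow> 'v::ab_group_add \<Rightarrow> 'v"
    and Basis :: "'v set"
    and r :: "'v set \<Rightarrow> int"
    and form :: "'v \<Rightarrow> 'v \<Rightarrow> 'f"
    and A :: "'v set"
    and a :: int
  assumes "q_matroid scale Basis r"
    and "nondegenerate_form scale form"
    and "module.subspace scale A"
    and "finite_field_space.nullity scale r A = a"
  shows "(finite_field_space.cyclic_subspace scale r A \<longleftrightarrow>
            (A \<in> finite_field_space.subspaces_of_nullity scale r a \<and>
             (\<forall>B \<in> finite_field_space.subspaces_of_nullity scale r a. B \<subseteq> A \<longrightarrow> B = A)))
       \<and> ((A \<in> finite_field_space.subspaces_of_nullity scale r a \<and>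
             (\<forall>B \<in> finite_field_space.subspaces_of_nullity scale r a. B \<subseteq> A \<longrightarrow> B = A)) \<longleftrightarrow>
          finite_field_space.flat scale (finite_field_space.dual_rank scale form r)
            (orthogonal_complement form A))"
proof -
  interpret M: q_matroid scale Basis r by fact
  interpret F: nondegenerate_form scale form by fact
  interpret q_matroid_form scale Basis r form ..
  show ?thesis
    \<comment> \<open>Minimality and flatness of the complement are linked through
      cyclicity.\<close>
    using M.cyclic_subspace_iff_minimal_nullity[OF assms(3,4)]
      cyclic_subspace_iff_flat_dual[OF assms(3)] by blast
qed

end
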